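(* There exists a setting (with pairwise distinct budgets) in which the budget-conscious by price second-price auction (BCP) has no pure Nash equilibrium, where each player's strategy is a pair (value-bid, budget-bid).
   Context: Setting: there are $k\ge 1$ slots with public click-through rates $\theta_1>\theta_2>\dots>\theta_k>0$, and $n\ge k$ players. Player $i$ has a private value per click $v_i\ge 0$ and a budget $B_i>0$; the budgets $B_1,\dots,B_n$ are pairwise distinct. A setting consists of $k,n,(\theta_j),(v_i),(B_i)$ together with a fixed strict priority order on the players used to break all ties. Each player $i$ submits a value-bid $b_i\ge 0$ and a budget-bid $g_i\ge 0$; a mechanism outputs an injective partial slot assignment (assigned player $i$ gets slot $s(i)\in\{1,\dots,k\}$) and a price per click $p(i)\ge0$ for each assigned player; unassigned players pay nothing. The utility of player $i$ is $u_i=0$ if $i$ is unassigned, $u_i=\theta_{s(i)}(v_i-p(i))$ if $i$ is assigned and $\theta_{s(i)}p(i)\le B_i$, and $u_i=-\infty$ if $i$ is assigned and $\theta_{s(i)}p(i)>B_i$. A (pure) Nash equilibrium is a profile $(b_i,g_i)_{i}$ such that no player $i$ can strictly increase $u_i$ by unilaterally replacing $(b_i,g_i)$ with any other pair. BCP: order the players by decreasing value-bid (ties broken by the priority order); each player's tentative price per click is the value-bid of the player immediately after him in this order (0 for the last player). Then process the players in this order; each player $i$ is assigned the highest-CTR slot $s$ not yet assigned such that $\theta_s\cdot(\text{his price})\le g_i$, and pays that price per click; if no unassigned slot satisfies this, he is left unassigned and pays nothing. *)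

theory Defs
  imports Complex_Main "HOL-Library.Extended_Real"
begin

text \<open>Players are 0..<n, slots are 0..<k (slot s has CTR th s; slot 0 is the best).
  The priority order is given by an injective rank function pr on the players:
  player i has priority over player j iff pr i < pr j.
  A bid profile is given by value-bids b and budget-bids g (functions on players).\<close>

definition valid_setting ::
  "nat \<Rightarrow> nat \<Rightarrow> (nat \<Rightarrow> real) \<Rightarrow> (nat \<Rightarrow> real) \<Rightarrow> (nat \<Rightarrow> real) \<Rightarrow> (nat \<Rightarrow> nat) \<Rightarrow> bool" where
  "valid_setting k n th v B pr \<longleftrightarrow>
     1 \<le> k \<and> k \<le> n \<and>
     (\<forall>s t. s < t \<and> t < k \<longrightarrow> th t < th s) \<and> th (k - 1) > 0 \<and>
     (\<forall>i<n. v i \<ge> 0) \<and> (\<forall>i<n. B i > 0) \<and> inj_on B {0..<n} \<and>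
     inj_on pr {0..<n}"

definition precedes :: "(nat \<Rightarrow> real) \<Rightarrow> (nat \<Rightarrow> nat) \<Rightarrow> nat \<Rightarrow> nat \<Rightarrow> bool" where
  "precedes b pr j i \<longleftrightarrow> b j > b i \<or> (b j = b i \<and> pr j < pr i)"

definition pos :: "nat \<Rightarrow> (nat \<Rightarrow> real) \<Rightarrow> (nat \<Rightarrow> nat) \<Rightarrow> nat \<Rightarrow> nat" where
  "pos n b pr i = card {j. j < n \<and> precedes b pr j i}"

definition player_at :: "nat \<Rightarrow> (nat \<Rightarrow> real) \<Rightarrow> (nat \<Rightarrow> nat) \<Rightarrow> nat \<Rightarrow> nat" where
  "player_at n b pr m = (THE j. j < n \<and> pos n b pr j = m)"

definition bcp_price :: "nat \<Rightarrow> (nat \<Rightarrow> real) \<Rightarrow> (nat \<Rightarrow> nat) \<Rightarrow> nat \<Rightarrow> real" where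
  "bcp_price n b pr i =
     (if Suc (pos n b pr i) < n then b (player_at n b pr (Suc (pos n b pr i))) else 0)"

text \<open>Slot assignment after processing the first m players of the order.
  Each processed player gets the highest-CTR free slot s (i.e. smallest index, since
  th is strictly decreasing) with th s * price \<le> budget-bid, if any.\<close>
fun bcp_alloc_upto ::
  "nat \<Rightarrow> nat \<Rightarrow> (nat \<Rightarrow> real) \<Rightarrow> (nat \<Rightarrow> real) \<Rightarrow> (nat \<Rightarrow> real) \<Rightarrow> (nat \<Rightarrow> nat)
     \<Rightarrow> nat \<Rightarrow> (nat \<Rightarrow> nat option)" where
  "bcp_alloc_upto k n th b g pr 0 = (\<lambda>_. None)"
| "bcp_alloc_upto k n th b g pr (Suc m) =
     (let A = bcp_alloc_upto k n th b g pr m;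
          i = player_at n b pr m;
          avail = {s. s < k \<and> (\<forall>j. A j \<noteq> Some s) \<and> th s * bcp_price n b pr i \<le> g i}
      in if avail = {} then A else A(i := Some (Min avail)))"

definition bcp_alloc ::
  "nat \<Rightarrow> nat \<Rightarrow> (nat \<Rightarrow> real) \<Rightarrow> (nat \<Rightarrow> real) \<Rightarrow> (nat \<Rightarrow> real) \<Rightarrow> (nat \<Rightarrow> nat)
     \<Rightarrow> nat \<Rightarrow> nat option" where
  "bcp_alloc k n th b g pr = bcp_alloc_upto k n th b g pr n"

definition bcp_utility ::
  "nat \<Rightarrow> nat \<Rightarrow> (nat \<Rightarrow> real) \<Rightarrow> (nat \<Rightarrow> real) \<Rightarrow> (nat \<Rightarrow> real) \<Rightarrow> (nat \<Rightarrow> nat)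
     \<Rightarrow> (nat \<Rightarrow> real) \<Rightarrow> (nat \<Rightarrow> real) \<Rightarrow> nat \<Rightarrow> ereal" where
  "bcp_utility k n th v B pr b g i =
     (case bcp_alloc k n th b g pr i of
        None \<Rightarrow> 0
      | Some s \<Rightarrow>
          (if th s * bcp_price n b pr i \<le> B i
           then ereal (th s * (v i - bcp_price n b pr i)) else -\<infinity>))"

definition bcp_nash ::
  "nat \<Rightarrow> nat \<Rightarrow> (nat \<Rightarrow> real) \<Rightarrow> (nat \<Rightarrow> real) \<Rightarrow> (nat \<Rightarrow> real) \<Rightarrow> (nat \<Rightarrow> nat)
     \<Rightarrow> (nat \<Rightarrow> real) \<Rightarrow> (nat \<Rightarrow> real) \<Rightarrow> bool" where
  "bcp_nash k n th v B pr b g \<longleftrightarrow>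
     (\<forall>i<n. b i \<ge> 0 \<and> g i \<ge> 0) \<and>
     (\<forall>i<n. \<forall>b' g'. b' \<ge> 0 \<and> g' \<ge> 0 \<longrightarrow>
        \<not> (bcp_utility k n th v B pr (b(i := b')) (g(i := g')) i
             > bcp_utility k n th v B pr b g i))"

end

theory Submission
  imports Defs
begin

text \<open>The setting has four slots with click-through rates 4, 3, 2, 1 and four players with a common
  value 1000 and budgets 100, 101, 102, 103, so that any affordable better slot beats any worse
  slot and only affordability matters; ties favour the smaller budget. Let \<open>x0, x1, x2, x3\<close> be the
  players of an equilibrium in decreasing order of their bids \<open>b0 \<ge> b1 \<ge> b2 \<ge> b3\<close>; they pay
  \<open>b1, b2, b3, 0\<close>. Bidding 0 secures some slot for free, so everybody is assigned a slot and the
  worst one goes to \<open>x3\<close>. Since \<open>x3\<close> cannot improve by bidding first or second,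
  \<open>3 b1\<close> exceeds his budget, hence \<open>x0\<close> has the slot of rate 3 or 2.

  If \<open>x0\<close> has rate 3, then \<open>x3\<close> could tie with \<open>x1\<close> and get rate 2 unless the tie is lost, so
  \<open>x1\<close> is poorer than \<open>x3\<close>, who is poorer than \<open>x0\<close>. If \<open>x1\<close> has rate 4, then \<open>x0\<close> gains by bidding
  just below him; if \<open>x1\<close> has rate 2, then he gains either by pushing \<open>x0\<close> down or by tying with \<open>x3\<close>.
  If \<open>x0\<close> has rate 2, then \<open>3 b2\<close> exceeds his budget, which rules out rate 4 for \<open>x1\<close>; otherwise
  \<open>x2\<close> has rate 4 and must declare a budget that \<open>x3\<close> cannot exhaust, and then \<open>x0\<close> gets rate 2 at
  the lower price \<open>b3\<close> by bidding just below \<open>x2\<close>.\<close>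

section \<open>Players sorted by value-bid\<close>

text \<open>An explicit list replaces \<open>pos\<close> and \<open>player_at\<close>, so that
  prices and slots can be read off by index.\<close>

definition ranking :: "nat \<Rightarrow> (nat \<Rightarrow> real) \<Rightarrow> (nat \<Rightarrow> nat) \<Rightarrow> nat list \<Rightarrow> bool" where
  "ranking n b pr xs \<longleftrightarrow> set xs = {0..<n} \<and> distinct xs \<and> sorted_wrt (precedes b pr) xs"

lemma precedes_irrefl: "\<not> precedes b pr i i"
  by (simp add: precedes_def)

lemma precedes_trans: "precedes b pr i j \<Longrightarrow> precedes b pr j l \<Longrightarrow> precedes b pr i l"
  by (auto simp: precedes_def)

lemma precedes_asym: "precedes b pr i j \<Longrightarrow> \<not> precedes b pr j i"
  by (auto simp: precedes_def)

lemma precedes_total: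
  "inj_on pr A \<Longrightarrow> i \<in> A \<Longrightarrow> j \<in> A \<Longrightarrow> i \<noteq> j \<Longrightarrow> precedes b pr i j \<or> precedes b pr j i"
  by (auto simp: precedes_def inj_on_def) (metis linorder_neqE_nat linorder_neqE_linordered_idom)

lemma ranking_exists:
  assumes "inj_on pr {0..<n}"
  obtains xs where "ranking n b pr xs"
proof -
  have "\<exists>xs. set xs = A \<and> distinct xs \<and> sorted_wrt (precedes b pr) xs"
    if "finite A" "A \<subseteq> {0..<n}" for A
    using that
  proof (induction A)
    case empty
    show ?case by (rule exI[of _ "[]"]) simp
  next
    case (insert a A)
    then obtain xs where xs: "set xs = A" "distinct xs" "sorted_wrt (precedes b pr) xs"
      by auto
    define us where "us = filter (\<lambda>j. precedes b pr j a) xs"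
    define ws where "ws = filter (\<lambda>j. \<not> precedes b pr j a) xs"
    have ws: "precedes b pr a w" if "w \<in> set ws" for w
    proof -
      have "w \<in> {0..<n}" "a \<in> {0..<n}" "w \<noteq> a" "\<not> precedes b pr w a"
        using that insert.hyps insert.prems xs(1) by (auto simp: ws_def)
      then show ?thesis
        using precedes_total[OF assms] by blast
    qed
    have "set (us @ a # ws) = insert a A" "distinct (us @ a # ws)"
      using xs insert.hyps by (auto simp: us_def ws_def)
    moreover have "sorted_wrt (precedes b pr) (us @ a # ws)"
      using xs(3) ws by (auto simp: sorted_wrt_append us_def ws_def sorted_wrt_filter
          intro: precedes_trans)
    ultimately show ?case by blast
  qed
  from this[of "{0..<n}"] show thesis
    using that by (auto simp: ranking_def)
qed

section \<open>The mechanism evaluated along a ranking\<close>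

context
  fixes n b pr xs
  assumes ranking: "ranking n b pr xs"
begin

lemma ranking_length: "length xs = n"
  using ranking distinct_card[of xs] by (simp add: ranking_def)

lemma ranking_pos:
  assumes "m < n"
  shows "pos n b pr (xs ! m) = m"
proof -
  have "{j. j < n \<and> precedes b pr j (xs ! m)} = set (take m xs)"
  proof (intro equalityI subsetI)
    fix j assume j: "j \<in> {j. j < n \<and> precedes b pr j (xs ! m)}"
    then have "j \<in> set xs"
      using ranking by (auto simp: ranking_def)
    then obtain r where r: "r < n" "xs ! r = j"
      by (metis in_set_conv_nth ranking_length)
    have "\<not> m < r"
      using j r precedes_asym sorted_wrt_nth_less[of "precedes b pr" xs m r] ranking
      by (auto simp: ranking_def ranking_length)
    moreover have "r \<noteq> m"
      using j r precedes_irrefl by auto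
    ultimately show "j \<in> set (take m xs)"
      using r ranking_length by (auto simp: in_set_conv_nth intro!: exI[of _ r])
  next
    fix j assume "j \<in> set (take m xs)"
    then obtain r where r: "r < m" "xs ! r = j"
      by (auto simp: in_set_conv_nth)
    then have "j \<in> set xs"
      using assms ranking_length by (metis nth_mem less_trans)
    then show "j \<in> {j. j < n \<and> precedes b pr j (xs ! m)}"
      using r assms ranking sorted_wrt_nth_less[of "precedes b pr" xs r m] ranking_length
      by (auto simp: ranking_def)
  qed
  then show ?thesis
    using assms ranking ranking_length by (simp add: pos_def ranking_def distinct_card)
qed

lemma ranking_player_at:
  assumes "m < n"
  shows "player_at n b pr m = xs ! m"
  unfolding player_at_def
proof (rule the_equality)
  show "xs ! m < n \<and> pos n b pr (xs ! m) = m"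
    using assms ranking ranking_pos ranking_length nth_mem[of m xs] by (auto simp: ranking_def)
next
  fix j assume "j < n \<and> pos n b pr j = m"
  then obtain r where "r < n" "xs ! r = j" "pos n b pr j = m"
    using ranking ranking_length by (metis atLeastLessThan_iff in_set_conv_nth ranking_def zero_le)
  then show "j = xs ! m"
    using ranking_pos by auto
qed

lemma ranking_price:
  assumes "m < n"
  shows "bcp_price n b pr (xs ! m) = (if Suc m < n then b (xs ! Suc m) else 0)"
  using assms by (simp add: bcp_price_def ranking_pos ranking_player_at)

lemma alloc_upto_unprocessed:
  assumes "m \<le> n" "j \<notin> set (take m xs)"
  shows "bcp_alloc_upto k n th b g pr m j = None"
  using assms
  by (induction m) (auto simp: Let_def ranking_player_at ranking_length take_Suc_conv_app_nth)

lemma alloc_upto_processed: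
  assumes "r < m" "m \<le> n"
  shows "bcp_alloc_upto k n th b g pr m (xs ! r) = bcp_alloc_upto k n th b g pr (Suc r) (xs ! r)"
  using assms
proof (induction m)
  case (Suc m)
  show ?case
  proof (cases "r = m")
    case False
    then have "xs ! r \<noteq> xs ! m"
      using Suc.prems ranking ranking_length by (simp add: ranking_def nth_eq_iff_index_eq)
    with False Suc show ?thesis
      by (auto simp: Let_def ranking_player_at simp del: bcp_alloc_upto.simps(2)
          simp add: bcp_alloc_upto.simps(2)[of _ _ _ _ _ _ m])
  qed simp
qed simp

lemma alloc_nth_processed:
  assumes "r < m" "m \<le> n"
  shows "bcp_alloc_upto k n th b g pr m (xs ! r) = bcp_alloc k n th b g pr (xs ! r)"
  using alloc_upto_processed[of r m] alloc_upto_processed[of r n] assms by (simp add: bcp_alloc_def)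

text \<open>The entries of the first \<open>m\<close> players are final after step \<open>m\<close>,
  so the slots free at that moment can be read off the final allocation.\<close>

lemma alloc_upto_free:
  assumes "m \<le> n"
  shows "(\<forall>j. bcp_alloc_upto k n th b g pr m j \<noteq> Some s) \<longleftrightarrow>
         (\<forall>r<m. bcp_alloc k n th b g pr (xs ! r) \<noteq> Some s)"
proof (intro iffI allI impI)
  fix r assume "\<forall>j. bcp_alloc_upto k n th b g pr m j \<noteq> Some s" "r < m"
  then show "bcp_alloc k n th b g pr (xs ! r) \<noteq> Some s"
    using alloc_nth_processed[of r m k th g] assms by metis
next
  fix j assume *: "\<forall>r<m. bcp_alloc k n th b g pr (xs ! r) \<noteq> Some s"
  show "bcp_alloc_upto k n th b g pr m j \<noteq> Some s"
  proof (cases "j \<in> set (take m xs)")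
    case True
    then obtain r where "r < m" "j = xs ! r"
      by (auto simp: in_set_conv_nth)
    then show ?thesis
      using * alloc_nth_processed[of r m k th g] assms by metis
  qed (simp add: alloc_upto_unprocessed assms)
qed

lemma alloc_nth:
  fixes th g k
  assumes "m < n"
  defines "avail \<equiv> {s. s < k \<and> (\<forall>r<m. bcp_alloc k n th b g pr (xs ! r) \<noteq> Some s) \<and>
                       th s * bcp_price n b pr (xs ! m) \<le> g (xs ! m)}"
  shows "bcp_alloc k n th b g pr (xs ! m) = (if avail = {} then None else Some (Min avail))"
proof -
  have "xs ! m \<notin> set (take m xs)"
    using assms(1) ranking ranking_length
    by (auto simp: ranking_def in_set_conv_nth nth_eq_iff_index_eq)
  then have none: "bcp_alloc_upto k n th b g pr m (xs ! m) = None"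
    using alloc_upto_unprocessed assms(1) by simp
  have "{s. s < k \<and> (\<forall>j. bcp_alloc_upto k n th b g pr m j \<noteq> Some s) \<and>
            th s * bcp_price n b pr (xs ! m) \<le> g (xs ! m)} = avail"
    using alloc_upto_free[of m k th g] assms(1) unfolding avail_def by (intro Collect_cong) simp
  then have "bcp_alloc_upto k n th b g pr (Suc m) (xs ! m) =
      (if avail = {} then None else Some (Min avail))"
    using assms(1) none by (simp only: bcp_alloc_upto.simps Let_def ranking_player_at) simp
  then show ?thesis
    using alloc_nth_processed[of m "Suc m" k th g] assms(1) by simp
qed

text \<open>Expands \<open>Min\<close> into a condition on the final slots of the players ahead;
  this is the form unfolded later for four players.\<close>

lemma alloc_nth_eq_Some_iff:
  assumes "m < n"
  shows "bcp_alloc k n th b g pr (xs ! m) = Some s \<longleftrightarrow>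
     s < k \<and> (\<forall>r<m. bcp_alloc k n th b g pr (xs ! r) \<noteq> Some s) \<and>
     th s * bcp_price n b pr (xs ! m) \<le> g (xs ! m) \<and>
     (\<forall>t<s. th t * bcp_price n b pr (xs ! m) \<le> g (xs ! m) \<longrightarrow>
       (\<exists>r<m. bcp_alloc k n th b g pr (xs ! r) = Some t))"
proof -
  define avail where "avail = {s. s < k \<and>
      (\<forall>r<m. bcp_alloc k n th b g pr (xs ! r) \<noteq> Some s) \<and>
      th s * bcp_price n b pr (xs ! m) \<le> g (xs ! m)}"
  have "finite avail"
    by (simp add: avail_def)
  then have "bcp_alloc k n th b g pr (xs ! m) = Some s \<longleftrightarrow> s \<in> avail \<and> (\<forall>t\<in>avail. s \<le> t)"
    unfolding alloc_nth[OF assms] avail_def[symmetric] by (auto simp: Min_eq_iff intro: Min_in)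
  moreover have "(\<forall>t\<in>avail. s \<le> t) \<longleftrightarrow> (\<forall>t<s. t \<notin> avail)"
    by (metis not_less)
  ultimately show ?thesis
    by (auto simp: avail_def)
qed

end

section \<open>Deviations from an equilibrium\<close>

text \<open>A deviator can obtain any slot that is free at his turn and within his budget by declaring
  exactly its cost; at price 0 he may instead get a better slot, which is no worse for him.\<close>

lemma nash_deviation:
  assumes setting: "valid_setting k n th v B pr"
    and nash: "bcp_nash k n th v B pr b g"
    and dev: "ranking n (b(i := \<beta>)) pr ys" "ys ! m = i" "m < n" "\<beta> \<ge> 0"
    and p: "p = (if Suc m < n then b (ys ! Suc m) else 0)"
    and s: "s < k" "th s * p \<le> B i"
      "\<forall>r<m. bcp_alloc k n th (b(i := \<beta>)) (g(i := th s * p)) pr (ys ! r) \<noteq> Some s"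
  shows "ereal (th s * (v i - p)) \<le> bcp_utility k n th v B pr b g i"
proof -
  have len: "length ys = n"
    using dev(1) by (rule ranking_length)
  have mem: "ys ! r < n" if "r < n" for r
    using that dev(1) len nth_mem[of r ys] by (auto simp: ranking_def)
  have "p \<ge> 0"
    using nash p mem by (auto simp: bcp_nash_def)
  have dist: "ys ! Suc m \<noteq> i" if "Suc m < n"
    using that dev len by (auto simp: ranking_def nth_eq_iff_index_eq)
  have th_mono: "th s \<le> th t" if "t \<le> s" for t
    using setting that s(1) by (cases "t = s") (auto simp: valid_setting_def intro: less_imp_le)
  have th_pos: "th s > 0"
  proof -
    have "th (k - 1) \<le> th s"
      using setting s(1) by (cases "s = k - 1") (auto simp: valid_setting_def intro: less_imp_le)
    then show ?thesis
      using setting by (auto simp: valid_setting_def)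
  qed
  define b' where "b' = b(i := \<beta>)"
  define g' where "g' = g(i := th s * p)"
  have rank: "ranking n b' pr ys"
    using dev(1) by (simp add: b'_def)
  have price: "bcp_price n b' pr i = p"
    using ranking_price[OF rank dev(3)] p dist dev(2) by (auto simp: b'_def)
  define avail where "avail = {t. t < k \<and>
      (\<forall>r<m. bcp_alloc k n th b' g' pr (ys ! r) \<noteq> Some t) \<and> th t * p \<le> th s * p}"
  have "s \<in> avail"
    using s by (auto simp: avail_def b'_def g'_def)
  moreover have "finite avail"
    by (simp add: avail_def)
  ultimately have min: "Min avail \<in> avail" "Min avail \<le> s"
    by (auto intro: Min_in)
  have alloc: "bcp_alloc k n th b' g' pr i = Some (Min avail)"
    using alloc_nth[OF rank dev(3), of k th g'] \<open>s \<in> avail\<close>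
    unfolding dev(2) price by (auto simp: avail_def g'_def)
  have cost: "th (Min avail) * p \<le> th s * p"
    using min(1) by (simp add: avail_def)
  have "bcp_utility k n th v B pr b' g' i = ereal (th (Min avail) * (v i - p))"
    using alloc cost s(2) by (simp add: bcp_utility_def price)
  \<comment> \<open>The slot obtained brings at least as many clicks as \<open>s\<close> and, by
    \<open>cost\<close>, no larger total payment.\<close>
  moreover have "th s * (v i - p) \<le> th (Min avail) * (v i - p)"
  proof -
    have "i < n"
      using mem dev by auto
    then have "v i \<ge> 0"
      using setting by (auto simp: valid_setting_def)
    then have "th s * v i \<le> th (Min avail) * v i"
      using th_mono[OF min(2)] by (rule mult_right_mono[rotated])
    with cost show ?thesis
      by (simp add: right_diff_distrib)
  qed
  moreover have "bcp_utility k n th v B pr b' g' i \<le> bcp_utility k n th v B pr b g i"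
    using nash mem[OF dev(3)] dev(2,4) \<open>p \<ge> 0\<close> th_pos
    by (auto simp: bcp_nash_def b'_def g'_def not_less)
  ultimately show ?thesis
    by (metis ereal_less_eq(3) order_trans)
qed

text \<open>After bidding 0 and declaring budget 0 the price is 0, since any follower must bid 0
  too. With as many slots as players some slot is still free at that turn, and every slot is worth
  at least the last one.\<close>

lemma nash_utility_ge_last_slot:
  assumes setting: "valid_setting n n th v B pr" and nash: "bcp_nash n n th v B pr b g" and "i < n"
  shows "ereal (th (n - 1) * v i) \<le> bcp_utility n n th v B pr b g i"
proof -
  obtain ys where rank: "ranking n (b(i := 0)) pr ys"
    using setting ranking_exists by (metis valid_setting_def)
  have len: "length ys = n"
    using rank by (rule ranking_length)
  obtain m where m: "m < n" "ys ! m = i"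
    using rank len \<open>i < n\<close> by (metis atLeastLessThan_iff in_set_conv_nth ranking_def zero_le)
  have price: "(if Suc m < n then b (ys ! Suc m) else 0) = 0"
  proof (cases "Suc m < n")
    case True
    then have "precedes (b(i := 0)) pr i (ys ! Suc m)" "ys ! Suc m \<noteq> i" "ys ! Suc m < n"
      using rank m len sorted_wrt_nth_less[of "precedes (b(i := 0)) pr" ys m "Suc m"]
        nth_mem[of "Suc m" ys]
      by (auto simp: ranking_def nth_eq_iff_index_eq)
    then have "b (ys ! Suc m) \<le> 0" "b (ys ! Suc m) \<ge> 0"
      using nash by (auto simp: precedes_def bcp_nash_def)
    then show ?thesis by simp
  qed simp
  define g' where "g' = g(i := 0)"
  \<comment> \<open>The value of \<open>the\<close> on an unassigned player is harmless: only the
    bound \<open>m\<close> on the size of the image matters.\<close>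
  define slot where "slot r = the (bcp_alloc n n th (b(i := 0)) g' pr (ys ! r))" for r
  have "card (slot ` {..<m}) < n"
    using card_image_le[of "{..<m}" slot] m(1) by simp
  then have "\<not> {..<n} \<subseteq> slot ` {..<m}"
    using card_mono[of "slot ` {..<m}" "{..<n}"] by auto
  then obtain s where s: "s < n" "s \<notin> slot ` {..<m}"
    by auto
  have "\<forall>r<m. bcp_alloc n n th (b(i := 0)) g' pr (ys ! r) \<noteq> Some s"
    using s(2) unfolding slot_def by (metis image_eqI lessThan_iff option.sel)
  then have "ereal (th s * (v i - 0)) \<le> bcp_utility n n th v B pr b g i"
    using setting s(1) \<open>i < n\<close>
    by (intro nash_deviation[OF setting nash rank m(2,1) _ price[symmetric]])
       (auto simp: g'_def valid_setting_def less_imp_le)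
  moreover have "th (n - 1) \<le> th s"
    using setting s(1) by (cases "s = n - 1") (auto simp: valid_setting_def intro: less_imp_le)
  then have "th (n - 1) * v i \<le> th s * v i"
    using setting \<open>i < n\<close> by (auto simp: valid_setting_def intro: mult_right_mono)
  ultimately show ?thesis
    by (metis diff_zero ereal_less_eq(3) order_trans)
qed

section \<open>Four players and four slots\<close>

text \<open>The choice of one player who faces the free slots \<open>F\<close> and price
  \<open>p\<close> with declared budget \<open>\<gamma>\<close>. As a relation it becomes plain
  linear inequalities for concrete slots.\<close>

definition takes :: "(nat \<Rightarrow> real) \<Rightarrow> nat set \<Rightarrow> real \<Rightarrow> real \<Rightarrow> nat \<Rightarrow> bool" where
  "takes th F p \<gamma> s \<longleftrightarrow> s \<in> F \<and> th s * p \<le> \<gamma> \<and> (\<forall>t\<in>F. t < s \<longrightarrow> \<gamma> < th t * p)"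

lemma takes_unique: "takes th F p \<gamma> s \<Longrightarrow> takes th F p \<gamma> t \<Longrightarrow> s = t"
  unfolding takes_def by (metis not_less linorder_neqE_nat)

lemma ranking_4_iff:
  "ranking 4 b pr [x0, x1, x2, x3] \<longleftrightarrow> {x0, x1, x2, x3} = {0..<4} \<and>
     precedes b pr x0 x1 \<and> precedes b pr x1 x2 \<and> precedes b pr x2 x3"
  unfolding ranking_def using precedes_trans precedes_irrefl by (simp, blast)

lemma price_4:
  assumes "ranking 4 b pr [x0, x1, x2, x3]"
  shows "bcp_price 4 b pr x0 = b x1" "bcp_price 4 b pr x1 = b x2"
    "bcp_price 4 b pr x2 = b x3" "bcp_price 4 b pr x3 = 0"
  using ranking_price[OF assms, of 0] ranking_price[OF assms, of 1]
    ranking_price[OF assms, of 2] ranking_price[OF assms, of 3] by simp_all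

lemma slots_4: "{..<4} = {0, 1, 2, 3 :: nat}"
  by auto

lemma alloc_4:
  fixes th g
  assumes rank: "ranking 4 b pr [x0, x1, x2, x3]"
  defines "A \<equiv> bcp_alloc 4 4 th b g pr"
  shows "A x0 = Some s \<longleftrightarrow> takes th {..<4} (b x1) (g x0) s"
    and "A x0 = Some s0 \<Longrightarrow> A x1 = Some s \<longleftrightarrow> takes th ({..<4} - {s0}) (b x2) (g x1) s"
    and "A x0 = Some s0 \<Longrightarrow> A x1 = Some s1 \<Longrightarrow>
      A x2 = Some s \<longleftrightarrow> takes th ({..<4} - {s0, s1}) (b x3) (g x2) s"
    and "A x0 = Some s0 \<Longrightarrow> A x1 = Some s1 \<Longrightarrow> A x2 = Some s2 \<Longrightarrow>
      A x3 = Some s \<longleftrightarrow> takes th ({..<4} - {s0, s1, s2}) 0 (g x3) s"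
proof -
  note eq = alloc_nth_eq_Some_iff[OF rank, where k = 4 and th = th and g = g and s = s, folded A_def]
  note simps = takes_def price_4[OF rank] numeral_2_eq_2 numeral_3_eq_3 All_less_Suc Ex_less_Suc
  show "A x0 = Some s \<longleftrightarrow> takes th {..<4} (b x1) (g x0) s"
    using eq[of 0] by (auto simp: simps not_le)
  show "A x1 = Some s \<longleftrightarrow> takes th ({..<4} - {s0}) (b x2) (g x1) s" if "A x0 = Some s0"
    using eq[of 1] that by (auto simp: simps not_le)
  show "A x2 = Some s \<longleftrightarrow> takes th ({..<4} - {s0, s1}) (b x3) (g x2) s"
    if "A x0 = Some s0" "A x1 = Some s1"
    using eq[of 2] that by (auto simp: simps not_le)
  show "A x3 = Some s \<longleftrightarrow> takes th ({..<4} - {s0, s1, s2}) 0 (g x3) s"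
    if "A x0 = Some s0" "A x1 = Some s1" "A x2 = Some s2"
    using eq[of 3] that by (auto simp: simps not_le)
qed

text \<open>One clause for each position where the deviator can land. Only the player directly ahead
  of him faces the price \<open>\<beta>\<close>; those further ahead pay bids taken from
  \<open>b\<close>.\<close>

lemma nash_deviation_4:
  assumes setting: "valid_setting 4 4 th v B pr" and nash: "bcp_nash 4 4 th v B pr b g"
    and "\<beta> \<ge> 0" "s < 4"
  defines "U \<equiv> bcp_utility 4 4 th v B pr b g"
  shows "ranking 4 (b(i := \<beta>)) pr [i, y0, y1, y2] \<Longrightarrow> th s * b y0 \<le> B i \<Longrightarrow>
      ereal (th s * (v i - b y0)) \<le> U i"
    and "ranking 4 (b(i := \<beta>)) pr [y0, i, y1, y2] \<Longrightarrow> th s * b y1 \<le> B i \<Longrightarrow>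
      \<not> takes th {..<4} \<beta> (g y0) s \<Longrightarrow> ereal (th s * (v i - b y1)) \<le> U i"
    and "ranking 4 (b(i := \<beta>)) pr [y0, y1, i, y2] \<Longrightarrow> th s * b y2 \<le> B i \<Longrightarrow>
      takes th {..<4} (b y1) (g y0) t0 \<Longrightarrow> s \<noteq> t0 \<Longrightarrow>
      \<not> takes th ({..<4} - {t0}) \<beta> (g y1) s \<Longrightarrow> ereal (th s * (v i - b y2)) \<le> U i"
    and "ranking 4 (b(i := \<beta>)) pr [y0, y1, y2, i] \<Longrightarrow> 0 \<le> B i \<Longrightarrow>
      takes th {..<4} (b y1) (g y0) t0 \<Longrightarrow> s \<noteq> t0 \<Longrightarrow>
      takes th ({..<4} - {t0}) (b y2) (g y1) t1 \<Longrightarrow> s \<noteq> t1 \<Longrightarrow>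
      \<not> takes th ({..<4} - {t0, t1}) \<beta> (g y2) s \<Longrightarrow> ereal (th s * v i) \<le> U i"
proof -
  have distinct: "distinct ys" if "ranking 4 (b(i := \<beta>)) pr ys" for ys
    using that by (simp add: ranking_def)
  note simps = numeral_2_eq_2 numeral_3_eq_3 All_less_Suc U_def
  show "ereal (th s * (v i - b y0)) \<le> U i"
    if "ranking 4 (b(i := \<beta>)) pr [i, y0, y1, y2]" "th s * b y0 \<le> B i"
    using nash_deviation[OF setting nash that(1), of 0 "b y0" s] that assms by simp
  show "ereal (th s * (v i - b y1)) \<le> U i"
    if rank: "ranking 4 (b(i := \<beta>)) pr [y0, i, y1, y2]" and "th s * b y1 \<le> B i"
      "\<not> takes th {..<4} \<beta> (g y0) s"
    using nash_deviation[OF setting nash rank, of 1 "b y1" s] that distinct[OF rank] assms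
      alloc_4(1)[OF rank, of th "g(i := th s * b y1)" s] by simp
  show "ereal (th s * (v i - b y2)) \<le> U i"
    if rank: "ranking 4 (b(i := \<beta>)) pr [y0, y1, i, y2]" and "th s * b y2 \<le> B i"
      "takes th {..<4} (b y1) (g y0) t0" "s \<noteq> t0" "\<not> takes th ({..<4} - {t0}) \<beta> (g y1) s"
    using nash_deviation[OF setting nash rank, of 2 "b y2" s] that distinct[OF rank] assms
      alloc_4(1)[OF rank, of th "g(i := th s * b y2)" t0]
      alloc_4(2)[OF rank, of th "g(i := th s * b y2)" t0 s] by (simp add: simps)
  show "ereal (th s * v i) \<le> U i"
    if rank: "ranking 4 (b(i := \<beta>)) pr [y0, y1, y2, i]" and "0 \<le> B i"
      "takes th {..<4} (b y1) (g y0) t0" "s \<noteq> t0"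
      "takes th ({..<4} - {t0}) (b y2) (g y1) t1" "s \<noteq> t1"
      "\<not> takes th ({..<4} - {t0, t1}) \<beta> (g y2) s"
    using nash_deviation[OF setting nash rank, of 3 0 s] that distinct[OF rank] assms
      alloc_4(1)[OF rank, of th "g(i := 0)" t0]
      alloc_4(2)[OF rank, of th "g(i := 0)" t0 t1]
      alloc_4(3)[OF rank, of th "g(i := 0)" t0 t1 s] by (simp add: simps)
qed

section \<open>The concrete setting and the case analysis\<close>

definition ctr :: "nat \<Rightarrow> real" where "ctr s = 4 - real s"

definition budget :: "nat \<Rightarrow> real" where "budget i = 100 + real i"

lemma setting_4: "valid_setting 4 4 ctr (\<lambda>_. 1000) budget id"
  by (auto simp: valid_setting_def ctr_def budget_def inj_on_def)

lemma takes_ctr_simps: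
  "takes ctr F p \<gamma> 0 \<longleftrightarrow> 0 \<in> F \<and> 4 * p \<le> \<gamma>"
  "takes ctr F p \<gamma> (Suc 0) \<longleftrightarrow> 1 \<in> F \<and> 3 * p \<le> \<gamma> \<and> (0 \<in> F \<longrightarrow> \<gamma> < 4 * p)"
  "takes ctr F p \<gamma> 2 \<longleftrightarrow> 2 \<in> F \<and> 2 * p \<le> \<gamma> \<and> (0 \<in> F \<longrightarrow> \<gamma> < 4 * p) \<and> (1 \<in> F \<longrightarrow> \<gamma> < 3 * p)"
  "takes ctr F p \<gamma> 3 \<longleftrightarrow> 3 \<in> F \<and> p \<le> \<gamma> \<and> (0 \<in> F \<longrightarrow> \<gamma> < 4 * p) \<and> (1 \<in> F \<longrightarrow> \<gamma> < 3 * p) \<and>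
     (2 \<in> F \<longrightarrow> \<gamma> < 2 * p)"
  by (auto simp: takes_def ctr_def less_Suc_eq numeral_2_eq_2 numeral_3_eq_3)

lemma no_equilibrium: "\<not> bcp_nash 4 4 ctr (\<lambda>_. 1000) budget id b g"
proof
  assume nash: "bcp_nash 4 4 ctr (\<lambda>_. 1000) budget id b g"
  let ?A = "bcp_alloc 4 4 ctr b g id" and ?U = "bcp_utility 4 4 ctr (\<lambda>_. 1000) budget id b g"
  note dev = nash_deviation_4[OF setting_4 nash]
  obtain xs where xs: "ranking 4 b id xs"
    using ranking_exists[of id 4] by auto
  then obtain x0 x1 x2 x3 where "xs = [x0, x1, x2, x3]"
    using ranking_length[OF xs] by (auto simp: numeral_eq_Suc length_Suc_conv)
  with xs have rank: "ranking 4 b id [x0, x1, x2, x3]"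
    by simp
  then have set: "{x0, x1, x2, x3} = {0..<4}" and distinct: "distinct [x0, x1, x2, x3]"
    by (auto simp: ranking_def)
  then have mem: "x0 < 4" "x1 < 4" "x2 < 4" "x3 < 4"
    by auto
  have nonneg: "b i \<ge> 0" "g i \<ge> 0" if "i < 4" for i
    using nash that by (auto simp: bcp_nash_def)
  have order: "b x0 \<ge> b x1" "b x1 \<ge> b x2" "b x2 \<ge> b x3" "b x3 \<ge> 0"
    using rank nonneg mem by (auto simp: ranking_4_iff precedes_def)
  have budget: "budget i \<ge> 100" "budget i \<le> 103" if "i < 4" for i
    using that by (auto simp: budget_def)
  note budgets = budget[OF mem(1)] budget[OF mem(2)] budget[OF mem(3)] budget[OF mem(4)]
  \<comment> \<open>The bound 1000 is the last rate 1 times the value 1000; it excludes both utility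
    0 and overspending.\<close>
  have assigned: "\<exists>s. ?A i = Some s \<and> ctr s * bcp_price 4 b id i \<le> budget i \<and>
      ?U i = ereal (ctr s * (1000 - bcp_price 4 b id i)) \<and>
      1000 \<le> ctr s * (1000 - bcp_price 4 b id i)" if "i < 4" for i
    using nash_utility_ge_last_slot[OF setting_4 nash that]
    by (auto simp: bcp_utility_def ctr_def split: option.splits if_splits)
  obtain s0 where s0: "?A x0 = Some s0" "ctr s0 * b x1 \<le> budget x0"
      "?U x0 = ereal (ctr s0 * (1000 - b x1))" "1000 \<le> ctr s0 * (1000 - b x1)"
    using assigned[OF mem(1)] by (auto simp: price_4[OF rank])
  obtain s1 where s1: "?A x1 = Some s1" "ctr s1 * b x2 \<le> budget x1"
      "?U x1 = ereal (ctr s1 * (1000 - b x2))" "1000 \<le> ctr s1 * (1000 - b x2)"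
    using assigned[OF mem(2)] by (auto simp: price_4[OF rank])
  obtain s2 where s2: "?A x2 = Some s2" "ctr s2 * b x3 \<le> budget x2"
      "?U x2 = ereal (ctr s2 * (1000 - b x3))" "1000 \<le> ctr s2 * (1000 - b x3)"
    using assigned[OF mem(3)] by (auto simp: price_4[OF rank])
  obtain s3 where s3: "?A x3 = Some s3" "?U x3 = ereal (ctr s3 * 1000)"
    using assigned[OF mem(4)] by (auto simp: price_4[OF rank])
  have t0: "takes ctr {..<4} (b x1) (g x0) s0"
    using s0(1) alloc_4(1)[OF rank] by simp
  have t1: "takes ctr ({..<4} - {s0}) (b x2) (g x1) s1"
    using s0(1) s1(1) alloc_4(2)[OF rank] by simp
  have t2: "takes ctr ({..<4} - {s0, s1}) (b x3) (g x2) s2"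
    using s0(1) s1(1) s2(1) alloc_4(3)[OF rank] by simp
  have t3: "takes ctr ({..<4} - {s0, s1, s2}) 0 (g x3) s3"
    using s0(1) s1(1) s2(1) s3(1) alloc_4(4)[OF rank] by simp
  have slots: "s0 \<in> {0, 1, 2, 3}" "s1 \<in> {0, 1, 2, 3} - {s0}" "s2 \<in> {0, 1, 2, 3} - {s0, s1}"
      "s3 \<in> {0, 1, 2, 3} - {s0, s1, s2}"
    using t0 t1 t2 t3 unfolding takes_def slots_4 by blast+

  \<comment> \<open>Whoever holds the worst slot must get it for free, so every better slot was gone at his turn.\<close>
  have "s0 \<noteq> 3"
    using t0 s0(4) nonneg[OF mem(1)] by (auto simp: takes_ctr_simps ctr_def)
  moreover have "s1 \<noteq> 3"
    using t1 s1(4) slots(1) nonneg[OF mem(2)] by (auto simp: takes_ctr_simps ctr_def)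
  moreover have "s2 \<noteq> 3"
    using t2 s2(4) slots(1,2) nonneg[OF mem(3)] by (auto simp: takes_ctr_simps ctr_def)
  ultimately have "s3 = 3"
    and cases: "s0 = 0 \<or> s0 = 1 \<and> s1 = 0 \<or> s0 = 1 \<and> s1 = 2 \<and> s2 = 0 \<or>
      s0 = 2 \<and> s1 = 0 \<or> s0 = 2 \<and> s1 = 1 \<and> s2 = 0"
    using slots by auto
  have U3: "?U x3 = ereal 1000"
    using s3(2) \<open>s3 = 3\<close> by (simp add: ctr_def)

  have perms: "{x3, x0, x1, x2} = {0..<4}" "{x0, x3, x1, x2} = {0..<4}" "{x1, x0, x2, x3} = {0..<4}"
    "{x0, x2, x1, x3} = {0..<4}" "{x1, x2, x0, x3} = {0..<4}"
    using set by auto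
  note rank_simps = ranking_4_iff precedes_def perms set ctr_def
  note simps = rank_simps takes_ctr_simps
  have chain: "precedes b id x0 x1" "precedes b id x1 x2" "precedes b id x2 x3"
    using rank by (auto simp: ranking_4_iff)
  \<comment> \<open>Otherwise \<open>x3\<close> could outbid everybody and buy slot 2 at price
    \<open>b x0\<close>. Later this bound separates \<open>b x0\<close> from \<open>b x1\<close>,
    leaving room for bids in between.\<close>
  have b0: "2 * b x0 > budget x3"
  proof (rule ccontr)
    assume neg: "\<not> 2 * b x0 > budget x3"
    then have "2 * (1000 - b x0) \<le> 1000"
      using dev(1)[of "b x0 + 1" 2 x3 x0 x1 x2] U3 order distinct chain by (auto simp: simps)
    with neg budgets show False by simp
  qed
  have b1: "3 * b x1 > budget x3"
  proof (rule ccontr)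
    assume neg: "\<not> 3 * b x1 > budget x3"
    \<comment> \<open>From the second position, two slots better than the worst are affordable, and \<open>x0\<close> takes
      at most one of them.\<close>
    define \<beta> where "\<beta> = (b x0 + b x1) / 2"
    have \<beta>: "b x1 < \<beta>" "\<beta> < b x0"
      using neg b0 budgets by (auto simp: \<beta>_def)
    have "\<not> takes ctr {..<4} \<beta> (g x0) 1 \<or> \<not> takes ctr {..<4} \<beta> (g x0) 2"
      using takes_unique by force
    then have "3 * (1000 - b x1) \<le> 1000 \<or> 2 * (1000 - b x1) \<le> 1000"
      using dev(2)[of \<beta> 1 x3 x0 x1 x2] dev(2)[of \<beta> 2 x3 x0 x1 x2] U3 \<beta> neg order distinct chain
      by (auto simp: rank_simps)
    with neg budgets show False by auto
  qed
  \<comment> \<open>A bid of exactly \<open>b x1\<close> by \<open>x3\<close> leaves the price of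
    \<open>x0\<close> unchanged, so \<open>x0\<close> keeps slot 1; if \<open>x3\<close> won the
    tie, he would get slot 2.\<close>
  have tie: "x1 < x3" if "s0 = 1"
  proof (rule ccontr)
    assume "\<not> x1 < x3"
    then have "x3 < x1"
      using distinct by auto
    have p1: "3 * b x1 \<le> budget x0" "3 * b x1 \<le> g x0"
      using s0(2) t0 that by (auto simp: simps)
    then have "2 * (1000 - b x1) \<le> 1000"
      using dev(2)[of "b x1" 2 x3 x0 x1 x2] U3 \<open>x3 < x1\<close> b0 order distinct chain budgets
      by (auto simp: simps)
    with p1 budgets show False by simp
  qed
  have second_price: "3 * b x2 > budget x0" if "s0 = 2"
  proof (rule ccontr)
    assume neg: "\<not> 3 * b x2 > budget x0"
    have p1: "2 * b x1 \<le> budget x0"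
      using s0(2) that by (simp add: ctr_def)
    \<comment> \<open>Otherwise \<open>x0\<close> could stay first and merely declare the cost of
      slot 1. The inequality makes \<open>b x2 < b x1\<close>.\<close>
    have "3 * b x1 > budget x0"
    proof (rule ccontr)
      assume "\<not> 3 * b x1 > budget x0"
      then have "3 * (1000 - b x1) \<le> 2 * (1000 - b x1)"
        using dev(1)[of "b x0" 1 x0 x1 x2 x3] s0(3) that rank order by (auto simp: ctr_def)
      with p1 budgets show False by simp
    qed
    define \<beta> where "\<beta> = (b x1 + b x2) / 2"
    have \<beta>: "b x2 < \<beta>" "\<beta> < b x1"
      using neg \<open>3 * b x1 > budget x0\<close> by (auto simp: \<beta>_def)
    \<comment> \<open>Now first, \<open>x1\<close> takes at most one of slots 1 and 2;
      \<open>x0\<close> affords either at the lower price \<open>b x2\<close>.\<close>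
    have "\<not> takes ctr {..<4} \<beta> (g x1) 1 \<or> \<not> takes ctr {..<4} \<beta> (g x1) 2"
      using takes_unique by force
    then have "3 * (1000 - b x2) \<le> 2 * (1000 - b x1) \<or> 2 * (1000 - b x2) \<le> 2 * (1000 - b x1)"
      using dev(2)[of \<beta> 1 x0 x1 x2 x3] dev(2)[of \<beta> 2 x0 x1 x2 x3] s0(3) that \<beta> neg
        order distinct chain by (auto simp: rank_simps)
    with \<beta> neg order budgets show False by auto
  qed
  have "s0 \<noteq> 0"
  proof
    assume "s0 = 0"
    then show False
      using b1 s0(2) budgets by (simp add: ctr_def)
  qed
  with cases consider "s0 = 1" "s1 = 0" | "s0 = 1" "s1 = 2" "s2 = 0"
    | "s0 = 2" "s1 = 0" | "s0 = 2" "s1 = 1" "s2 = 0"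
    by blast
  then show False
  proof cases
    case 1
    have "x1 < x3"
      using tie 1 by simp
    moreover have "x3 < x0"
      using b1 s0(2) 1 by (simp add: ctr_def budget_def)
    \<comment> \<open>Being richer than \<open>x1\<close>, \<open>x0\<close> also affords slot 0 at
      price \<open>b x2\<close>. Moving just behind \<open>x1\<close>, he gets whichever of slots 0
      and 1 \<open>x1\<close> leaves.\<close>
    ultimately have b2: "4 * b x2 < budget x0"
      using s1(2) 1 by (simp add: ctr_def budget_def)
    define \<beta> where "\<beta> = (b x1 + b x2) / 2"
    have \<beta>: "b x2 < \<beta>" "\<beta> < b x1"
      using b1 b2 budgets by (auto simp: \<beta>_def)
    have "\<not> takes ctr {..<4} \<beta> (g x1) 0 \<or> \<not> takes ctr {..<4} \<beta> (g x1) 1"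
      using takes_unique by force
    then have "4 * (1000 - b x2) \<le> 3 * (1000 - b x1) \<or> 3 * (1000 - b x2) \<le> 3 * (1000 - b x1)"
      using dev(2)[of \<beta> 0 x0 x1 x2 x3] dev(2)[of \<beta> 1 x0 x1 x2 x3] s0(3) 1 \<beta> b2 order distinct chain
      by (auto simp: rank_simps)
    with \<beta> order budgets b2 show False by auto
  next
    case 2
    have "x1 < x3"
      using tie 2 by simp
    have p1: "3 * b x1 \<le> budget x0" "3 * b x1 \<le> g x0"
      using s0(2) t0 2 by (auto simp: simps)
    have p2: "2 * b x2 \<le> budget x1"
      using s1(2) 2 by (simp add: ctr_def)
    have p3: "4 * b x3 \<le> budget x2" "4 * b x3 \<le> g x2"
      using s2(2) t2 2 by (auto simp: simps)
    have g0: "g x0 \<le> 3 * b x1"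
    proof (rule ccontr)
      assume neg: "\<not> g x0 \<le> 3 * b x1"
      \<comment> \<open>A slack in \<open>g x0\<close> lets \<open>x3\<close> bid strictly above
        \<open>x1\<close>, avoiding the lost tie, while \<open>x0\<close> can still pay for slot 1
        and so leaves slot 2.\<close>
      define \<beta> where "\<beta> = min ((b x0 + b x1) / 2) (g x0 / 3)"
      have \<beta>: "b x1 < \<beta>" "\<beta> < b x0" "3 * \<beta> \<le> g x0"
        using neg b0 p1 budgets by (auto simp: \<beta>_def min_def)
      have "2 * (1000 - b x1) \<le> 1000"
        using dev(2)[of \<beta> 2 x3 x0 x1 x2] U3 \<beta> p1 order distinct chain budgets by (auto simp: simps)
      with p1 budgets show False by simp
    qed
    have b2: "3 * b x2 > budget x1"
    proof (rule ccontr)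
      assume neg: "\<not> 3 * b x2 > budget x1"
      \<comment> \<open>By \<open>g0\<close> any price above \<open>b x1\<close> drives
        \<open>x0\<close> out of slot 1, which \<open>x1\<close> would then get at price
        \<open>b x2\<close>.\<close>
      define \<beta> where "\<beta> = (b x0 + b x1) / 2"
      have \<beta>: "b x1 < \<beta>" "\<beta> < b x0"
        using b0 p1 budgets by (auto simp: \<beta>_def)
      have "3 * (1000 - b x2) \<le> 2 * (1000 - b x2)"
        using dev(2)[of \<beta> 1 x1 x0 x2 x3] s1(3) 2 \<beta> g0 neg order distinct chain
        by (auto simp: simps)
      with p2 budgets show False by simp
    qed
    \<comment> \<open>Here \<open>x1\<close> drops to third place, winning the tie with
      \<open>x3\<close>. At price \<open>b x2\<close>, \<open>x0\<close> still takes slot 1, slot 0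
      being too dear by \<open>g0\<close> and \<open>b2\<close>; \<open>x2\<close> still pays
      \<open>b x3\<close> and takes slot 0. Slot 2 is left at the lower price
      \<open>b x3\<close>.\<close>
    have "2 * (1000 - b x3) \<le> 2 * (1000 - b x2)"
      using dev(3)[of "b x3" 2 x1 x0 x2 x3 1] s1(3) 2 p1 p3 g0 b0 b2 order distinct chain budgets
        \<open>x1 < x3\<close> by (auto simp: simps)
    with b2 p3 budgets show False by simp
  next
    case 3
    with second_price s1(2) budgets show False
      by (simp add: ctr_def)
  next
    case 4
    have b2: "3 * b x2 > budget x0"
      using second_price 4 by simp
    have p2: "3 * b x2 \<le> g x1" "g x1 < 4 * b x2"
      using t1 4 by (auto simp: simps)
    have p3: "4 * b x3 \<le> budget x2" "4 * b x3 \<le> g x2"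
      using s2(2) t2 4 by (auto simp: simps)
    have g2: "g x2 \<ge> 4 * b x2"
    proof (rule ccontr)
      assume neg: "\<not> g x2 \<ge> 4 * b x2"
      \<comment> \<open>Staying last, \<open>x3\<close> raises the price of \<open>x2\<close> beyond
        what \<open>g x2\<close> allows for slot 0 and receives that slot for free.\<close>
      define \<beta> where "\<beta> = (b x2 + g x2 / 4) / 2"
      have \<beta>: "b x3 < \<beta>" "\<beta> < b x2" "g x2 < 4 * \<beta>"
        using neg p3 by (auto simp: \<beta>_def)
      have t1': "takes ctr ({..<4} - {2}) (b x2) (g x1) 1" "takes ctr {..<4} (b x1) (g x0) 2"
        using t0 t1 4 by auto
      have "4 * 1000 \<le> (1000 :: real)"
        using dev(4)[of \<beta> 0 x3 x0 x1 x2 2 1] t1' U3 \<beta> order distinct chain budgets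
        by (auto simp: simps)
      then show False by simp
    qed
    define \<beta> where "\<beta> = (b x2 + b x3) / 2"
    have \<beta>: "b x3 < \<beta>" "\<beta> < b x2"
      using b2 p3 budgets by (auto simp: \<beta>_def)
    \<comment> \<open>With \<open>x0\<close> moved to third place, \<open>x1\<close> still faces
      \<open>b x2\<close> and takes slot 1 by \<open>p2\<close>, while \<open>x2\<close> faces less
      than \<open>b x2\<close> and takes slot 0 by \<open>g2\<close>.\<close>
    have "2 * (1000 - b x3) \<le> 2 * (1000 - b x1)"
      using dev(3)[of \<beta> 2 x0 x1 x2 x3 1] s0(3) 4 \<beta> p2 p3 g2 order distinct chain budgets
      by (auto simp: simps)
    with \<beta> order show False by simp
  qed
qed

theorem theorem2:
  shows "\<exists>k n th v B pr. valid_setting k n th v B pr \<and>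
           \<not> (\<exists>b g. bcp_nash k n th v B pr b g)"
  using setting_4 no_equilibrium by blast

end
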